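(* Let $\alpha\in[0,1]$ and $\beta\in(0,1]$. Assume that: (a) $f(x,y,\cdot):Z\to\mathbb R^d$ is continuous for all $x\in\Omega_1$ and almost all $y\in\Omega$; (b) for every $r>0$ there is an integrable function $\bar h_r:\Omega\to\mathbb R_+$ such that for almost all $y\in\Omega$ one has $|f(x,y,z)-f(\bar x,y,z)|\le\bar h_r(y)d(x,\bar x)^\beta$ for all $x,\bar x\in\Omega_1$, $z\in Z\cap\bar B_r(0)$; (c) $f(x,\cdot,z):\Omega\to\mathbb R^d$ is measurable for all $x\in\Omega_1$, $z\in Z$, and for every $r>0$ there is a function $b_r:\Omega_1\times\Omega\to\mathbb R_+$, measurable in the second argument, with $\sup_{\xi\in\Omega_1}\int_\Omega b_r(\xi,y)\,d\mu(y)<\infty$, such that for almost all $y\in\Omega$ one has $|f(x,y,z)|\le b_r(x,y)$ for all $x\in\Omega_1$, $z\in Z\cap\bar B_r(0)$. Then the Urysohn operator $\mathscr U:U_\alpha\to C^\beta_d(\Omega_1)$, $\mathscr U(u):=\int_\Omega f(\cdot,y,u(y))\,d\mu(y)$, is well-defined and bounded. If additionally (d) for every $r>0$ there is a function $c_r:\mathbb R_+\times\Omega\to\mathbb R_+$, measurable in the second argument, with $\lim_{\delta\searrow0}\int_\Omega c_r(\delta,y)\,d\mu(y)=0$, such that for almost all $y\in\Omega$ and all $\delta>0$ the implication $$|z-\bar z|\le\delta\ \Rightarrow\ \bigl|f(x,y,z)-f(x,y,\bar z)-[f(\bar x,y,z)-f(\bar x,y,\bar z)]\bigr|\le c_r(\delta,y)d(x,\bar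 x)^\beta$$ holds for all $x,\bar x\in\Omega_1$ and $z,\bar z\in Z\cap\bar B_r(0)$, then $\mathscr U$ is continuous.
   Context: Notation: $\mathbb R_+=[0,\infty)$; $|\cdot|$ denotes norms on finite-dimensional spaces; $\bar B_r(0)=\{z\in\mathbb R^n:|z|\le r\}$; $d(\cdot,\cdot)$ denotes the metric of any metric space considered, while $d$ alone is a dimension. For a metric space $X$ and $m\in\mathbb N$, $C^0_m(X)$ is the space of bounded continuous $u:X\to\mathbb R^m$ with norm $\|u\|_0=\sup_{x\in X}|u(x)|$. For $\alpha\in(0,1]$, $[u]_\alpha:=\sup_{x\neq\bar x}|u(x)-u(\bar x)|/d(x,\bar x)^\alpha$, and $C^\alpha_m(X)$ is the space of bounded $u:X\to\mathbb R^m$ with $[u]_\alpha<\infty$, normed by $\|u\|_\alpha=\max\{\|u\|_0,[u]_\alpha\}$. Setting: $\Omega,\Omega_1$ are metric spaces, $\Omega$ is compact, $(\Omega,\mathfrak A,\mu)$ is a measure space with $\mu(\Omega)<\infty$ whose $\sigma$-algebra contains the Borel sets; measurability, integrability and "almost all" refer to it. $Z\subseteq\mathbb R^n$ is nonempty, $U_\alpha:=\{u:\Omega\to Z\mid u\in C^\alpha_n(\Omega)\}$ (a subset of $C^\alpha_n(\Omega)$), and $f:\Omega_1\times\Omega\times Z\to\mathbb R^d$ is a function. Conventions: a map is bounded if it maps bounded sets to bounded sets; here this is understood in the strong sense that images of $\|\cdot\|_0$-bounded subsets of $U_\alpha$ are bounded. Continuity is understood in the strong sense that $u_l,u\in U_\alpha$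 and $\|u_l-u\|_0\to0$ already imply $\|\mathscr U(u_l)-\mathscr U(u)\|_\beta\to0$.
   Formalization: Continuity of U in the full β-norm is proved only for bounded Ω₁ (it fails for unbounded Ω₁, since (d) controls only the Hölder seminorm); for general Ω₁ only [U(u_l)−U(u)]_β→0 is proved. Integrals are taken with respect to the completion of μ. *)

theory Defs
  imports "HOL-Analysis.Analysis"
begin

text \<open>
  Suprema are taken in \<^typ>\<open>ennreal\<close>, so that an unbounded function has norm \<open>\<infinity>\<close> and a supremum
  over the empty set is \<open>0\<close>. Functions on a metric space \<open>X\<close> are total functions of which only
  the values on the carrier \<open>X\<close> matter.
\<close>

definition sup_norm_on :: "'a set \<Rightarrow> ('a \<Rightarrow> 'b::real_normed_vector) \<Rightarrow> ennreal" where
  "sup_norm_on X u = (SUP x\<in>X. ennreal (norm (u x)))"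

definition holder_seminorm_on ::
  "real \<Rightarrow> 'a::metric_space set \<Rightarrow> ('a \<Rightarrow> 'b::real_normed_vector) \<Rightarrow> ennreal" where
  "holder_seminorm_on \<alpha> X u =
     (SUP (x, x')\<in>{(x, x'). x \<in> X \<and> x' \<in> X \<and> x \<noteq> x'}.
        ennreal (norm (u x - u x') / dist x x' powr \<alpha>))"

text \<open>The exponent \<open>0\<close> stands for the bounded continuous functions with the supremum norm.\<close>

definition holder_norm_on ::
  "real \<Rightarrow> 'a::metric_space set \<Rightarrow> ('a \<Rightarrow> 'b::real_normed_vector) \<Rightarrow> ennreal" where
  "holder_norm_on \<alpha> X u =
     (if \<alpha> = 0 then sup_norm_on X u
      else max (sup_norm_on X u) (holder_seminorm_on \<alpha> X u))"

definition holder_space ::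
  "real \<Rightarrow> 'a::metric_space set \<Rightarrow> ('a \<Rightarrow> 'b::real_normed_vector) set" where
  "holder_space \<alpha> X =
     {u. bounded (u ` X) \<and>
         (if \<alpha> = 0 then continuous_on X u else holder_seminorm_on \<alpha> X u < \<infinity>)}"

definition holder_maps ::
  "real \<Rightarrow> 'a::metric_space set \<Rightarrow> 'b::real_normed_vector set \<Rightarrow> ('a \<Rightarrow> 'b) set" where
  "holder_maps \<alpha> X Z = {u \<in> holder_space \<alpha> X. u ` X \<subseteq> Z}"

text \<open>
  The integrand \<open>y \<mapsto> f(x,y,u(y))\<close> is in general only an almost everywhere limit of measurable
  functions. As the measure need not be complete, the integral is taken with respect to the
  completion; for measurable integrands this is the integral with respect to \<open>M\<close>.
\<close>

definition urysohn ::
  "'a measure \<Rightarrow> ('b \<Rightarrow> 'a \<Rightarrow> 'c \<Rightarrow> 'd::{banach, second_countable_topology})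
     \<Rightarrow> ('a \<Rightarrow> 'c) \<Rightarrow> 'b \<Rightarrow> 'd" where
  "urysohn M f u x = (\<integral>y. f x y (u y) \<partial>completion M)"

end

theory Submission
  imports Defs
begin

text \<open>
  Each part of the theorem is an estimate for an integral that depends on a parameter. The
  Hoelder bound on \<open>f\<close> in (b) and the bound on its mixed differences in (d) both have the shape
  \<open>norm (F x y - F x' y) \<le> c y * dist x x' powr \<beta>\<close>, and integrating this over \<open>y\<close> shows that the
  Hoelder seminorm of \<open>x \<mapsto> \<integral>F x\<close> is at most \<open>\<integral>c\<close> (\<open>holder_seminorm_integral_le\<close>). With
  \<open>F x y = f x y (u y)\<close>, and with (c) bounding the sup norm, this gives well-definedness and
  boundedness, the constants depending on \<open>u\<close> through a sup bound \<open>r\<close> only. With \<open>F x y = f x y (v y) - f x y (u y)\<close> and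
  \<open>norm (v y - u y) \<le> \<delta>\<close> it bounds the seminorm of the difference of the images by
  \<open>\<integral>c \<delta>\<close>, which is small for small \<open>\<delta>\<close>.

  The sup norm of the difference is not controlled by (d). At a single point \<open>x0\<close> it tends to \<open>0\<close> by
  dominated convergence, (a) giving the pointwise limit and (c) the majorant; on a bounded parameter
  set the seminorm carries this convergence from \<open>x0\<close> to all points uniformly
  (\<open>sup_norm_on_le_holder_seminorm_on\<close>).

  What remains is measurability of \<open>y \<mapsto> f x y (u y)\<close>. Since \<open>f x y\<close> is continuous for almost all
  \<open>y\<close> only, it is obtained for the completed measure, by approximating \<open>u\<close> with maps of
  countably many values in \<open>Z\<close> (\<open>borel_measurable_completion_superposition\<close>).
\<close>

section \<open>Measurability of superpositions\<close>

text \<open>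
  Completeness matters here: the sets where two almost everywhere equal functions take values in
  \<open>A\<close> differ by a subset of a null set, which need not be measurable for \<open>M\<close> itself.
\<close>

lemma borel_measurable_completion_AE_eq:
  fixes g g' :: "'a \<Rightarrow> 'b::topological_space"
  assumes g: "g \<in> borel_measurable (completion M)"
    and eq: "AE y in M. g y = g' y"
  shows "g' \<in> borel_measurable (completion M)"
proof (rule measurableI)
  fix A :: "'b set" assume "A \<in> sets borel"
  with g have meas: "g -` A \<inter> space M \<in> sets (completion M)"
    by (metis measurable_sets space_completion)
  have ae: "AE y in completion M. y \<in> g -` A \<inter> space M \<longleftrightarrow> y \<in> g' -` A \<inter> space M"
    using AE_completion[OF eq] by eventually_elim auto
  show "g' -` A \<inter> space (completion M) \<in> sets (completion M)"
    using completion.in_sets_AE[OF ae meas] by simp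
qed simp

text \<open>
  A countable dense subset of \<open>Z\<close> is enumerated, and \<open>s k\<close> picks the first of its points that
  is within distance \<open>1 / Suc k\<close> of \<open>u y\<close>. On each of the countably many level sets of \<open>s k\<close> the
  composition with \<open>g\<close> is one of the measurable functions \<open>\<lambda>y. g y z\<close>. The points are chosen in
  \<open>Z\<close>, because \<open>g y\<close> is continuous there only.
\<close>

lemma borel_measurable_completion_superposition:
  fixes g :: "'a \<Rightarrow> 'c::{metric_space, second_countable_topology} \<Rightarrow> 'd::metric_space"
  assumes u [measurable]: "u \<in> borel_measurable M" and uZ: "u ` space M \<subseteq> Z"
    and g: "\<And>z. z \<in> Z \<Longrightarrow> (\<lambda>y. g y z) \<in> borel_measurable M"
    and cont: "AE y in M. continuous_on Z (g y)"
  shows "(\<lambda>y. g y (u y)) \<in> borel_measurable (completion M)"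
proof (cases "Z = {}")
  case True
  with uZ have "space (completion M) = {}" by simp
  then show ?thesis by (simp add: measurable_def)
next
  case False
  obtain D where D: "countable D" "D \<subseteq> Z" "Z \<subseteq> closure D"
    using separable[of Z] by blast
  with False have "D \<noteq> {}" by auto
  define e where "e = from_nat_into D"
  have eZ: "e j \<in> Z" for j
    using from_nat_into[OF \<open>D \<noteq> {}\<close>] D(2) unfolding e_def by blast
  define J where "J k y = (LEAST j. dist (u y) (e j) < 1 / real (Suc k))" for k y
  define s where "s k y = e (J k y)" for k y
  have [measurable]: "J k \<in> measurable M (count_space UNIV)" for k
    unfolding J_def by measurable
  have close: "dist (u y) (s k y) < 1 / real (Suc k)" if "y \<in> space M" for k y
  proof -
    have "u y \<in> closure D" using that uZ D(3) by auto
    then obtain p where "p \<in> D" "dist p (u y) < 1 / real (Suc k)"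
      unfolding closure_approachable by (metis of_nat_0_less_iff zero_less_Suc zero_less_divide_1_iff)
    moreover have "\<exists>j. e j = p"
      using \<open>p \<in> D\<close> D(1) unfolding e_def by (metis from_nat_into_surj)
    ultimately have "\<exists>j. dist (u y) (e j) < 1 / real (Suc k)"
      by (auto simp: dist_commute)
    then show ?thesis unfolding s_def J_def by (rule LeastI_ex)
  qed
  have lim_s: "(\<lambda>k. s k y) \<longlonglongrightarrow> u y" if "y \<in> space M" for y
  proof -
    have "(\<lambda>k. dist (s k y) (u y)) \<longlonglongrightarrow> 0"
    proof (rule tendsto_sandwich[OF _ _ tendsto_const LIMSEQ_Suc[OF lim_1_over_n]])
      show "\<forall>\<^sub>F k in sequentially. dist (s k y) (u y) \<le> 1 / of_nat (Suc k)"
        using close[OF that] by (intro always_eventually allI) (metis dist_commute less_imp_le)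
    qed simp
    then show ?thesis by (rule tendstoI[OF order_tendstoD(2)])
  qed
  have gs: "(\<lambda>y. g y (s k y)) \<in> borel_measurable M" for k
    unfolding s_def
    by (rule measurable_compose_countable'[where I = UNIV and f = "\<lambda>j y. g y (e j)"])
       (auto intro: g eZ)
  obtain N where N: "N \<in> null_sets M" "{y \<in> space M. \<not> continuous_on Z (g y)} \<subseteq> N"
    using cont by (auto elim!: AE_E intro: that[OF null_setsI])
  \<comment> \<open>On the null set \<open>N\<close> the compositions need not converge, so they are replaced there by a
    constant.\<close>
  define G where "G y = (if y \<in> N then undefined else g y (u y))" for y
  have "G \<in> borel_measurable M"
  proof (rule borel_measurable_LIMSEQ_metric)
    show "(\<lambda>y. if y \<in> N then undefined else g y (s k y)) \<in> borel_measurable M" for k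
      using gs N(1) by (intro measurable_If_set) auto
    show "(\<lambda>k. if y \<in> N then undefined else g y (s k y)) \<longlonglongrightarrow> G y" if y: "y \<in> space M" for y
    proof (cases "y \<in> N")
      case False
      then have "continuous_on Z (g y)" using N(2) y by auto
      then have "(\<lambda>k. g y (s k y)) \<longlonglongrightarrow> g y (u y)"
        by (rule continuous_on_tendsto_compose[OF _ lim_s[OF y]]) (use eZ uZ y in \<open>auto simp: s_def\<close>)
      with False show ?thesis by (simp add: G_def)
    qed (simp add: G_def)
  qed
  then have "G \<in> borel_measurable (completion M)"
    by (rule measurable_completion)
  moreover have "AE y in M. G y = g y (u y)"
    using AE_not_in[OF N(1)] by eventually_elim (simp add: G_def)
  ultimately show ?thesis
    by (rule borel_measurable_completion_AE_eq)
qed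

section \<open>Sup norms and Hoelder seminorms\<close>

lemma norm_le_sup_norm_on: "x \<in> X \<Longrightarrow> ennreal (norm (u x)) \<le> sup_norm_on X u"
  unfolding sup_norm_on_def by (rule SUP_upper)

lemma sup_norm_on_le:
  "(\<And>x. x \<in> X \<Longrightarrow> ennreal (norm (u x)) \<le> C) \<Longrightarrow> sup_norm_on X u \<le> C"
  unfolding sup_norm_on_def by (rule SUP_least)

lemma bounded_image_if_sup_norm_on_finite:
  assumes "sup_norm_on X u < \<infinity>"
  shows "bounded (u ` X)"
proof -
  obtain C where "0 \<le> C" "sup_norm_on X u = ennreal C"
    using assms by (cases "sup_norm_on X u") auto
  then have "norm (u x) \<le> C" if "x \<in> X" for x
    using norm_le_sup_norm_on[OF that, of u] by simp
  then show ?thesis by (auto intro: boundedI)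
qed

text \<open>
  The next two lemmas trade the difference quotients in the seminorm for products. The product form
  also covers equal points and infinite constants.
\<close>

lemma norm_diff_le_holder_seminorm_on:
  assumes "x \<in> X" "x' \<in> X"
  shows "ennreal (norm (u x - u x')) \<le> holder_seminorm_on \<beta> X u * ennreal (dist x x' powr \<beta>)"
proof (cases "x = x'")
  case False
  then have "0 < dist x x' powr \<beta>" by simp
  then have "ennreal (norm (u x - u x'))
      = ennreal (norm (u x - u x') / dist x x' powr \<beta>) * ennreal (dist x x' powr \<beta>)"
    by (subst ennreal_mult''[symmetric]) auto
  also have "\<dots> \<le> holder_seminorm_on \<beta> X u * ennreal (dist x x' powr \<beta>)"
    unfolding holder_seminorm_on_def using assms False
    by (intro mult_right_mono SUP_upper2[where i = "(x, x')"]) auto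
  finally show ?thesis .
qed simp

lemma holder_seminorm_on_le:
  assumes "\<And>x x'. x \<in> X \<Longrightarrow> x' \<in> X \<Longrightarrow>
    ennreal (norm (u x - u x')) \<le> C * ennreal (dist x x' powr \<beta>)"
  shows "holder_seminorm_on \<beta> X u \<le> C"
  unfolding holder_seminorm_on_def
proof (rule SUP_least, clarify)
  fix x x' assume x: "x \<in> X" "x' \<in> X" "x \<noteq> x'"
  then have d: "0 < dist x x' powr \<beta>" by simp
  show "ennreal (norm (u x - u x') / dist x x' powr \<beta>) \<le> C"
  proof (cases C)
    case (real c)
    then have "ennreal (norm (u x - u x')) \<le> ennreal (c * dist x x' powr \<beta>)"
      using assms[OF x(1,2)] by (simp add: ennreal_mult)
    then have "norm (u x - u x') \<le> c * dist x x' powr \<beta>"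
      using real d by (subst (asm) ennreal_le_iff) auto
    with real d show ?thesis by (simp add: divide_le_eq)
  qed simp
qed

lemma continuous_on_if_holder_seminorm_on_finite:
  assumes "0 < \<alpha>" and "holder_seminorm_on \<alpha> X u < \<infinity>"
  shows "continuous_on X u"
proof -
  obtain C where C: "0 \<le> C" "holder_seminorm_on \<alpha> X u = ennreal C"
    using assms(2) by (cases "holder_seminorm_on \<alpha> X u") auto
  have bound: "norm (u x' - u x) \<le> C * dist x' x powr \<alpha>" if "x \<in> X" "x' \<in> X" for x x'
    using norm_diff_le_holder_seminorm_on[OF that(2,1), of u \<alpha>] C
    by (simp add: ennreal_mult[symmetric])
  show ?thesis
    unfolding continuous_on_def
  proof
    fix x assume x: "x \<in> X"
    have "((\<lambda>x'. dist x' x) \<longlongrightarrow> 0) (at x within X)"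
      by (rule tendsto_eq_rhs[OF tendsto_dist[OF tendsto_ident_at tendsto_const]]) simp
    then have "((\<lambda>x'. C * dist x' x powr \<alpha>) \<longlongrightarrow> 0) (at x within X)"
      using assms(1) by (intro tendsto_mult_right_zero tendsto_zero_powrI[where b = \<alpha>]) auto
    then have "((\<lambda>x'. u x' - u x) \<longlongrightarrow> 0) (at x within X)"
      by (rule Lim_null_comparison[rotated])
         (use bound[OF x] in \<open>auto simp: eventually_at_filter\<close>)
    then show "(u \<longlongrightarrow> u x) (at x within X)" by (rule LIM_zero_cancel)
  qed
qed

lemma holder_space_continuous_on:
  "0 \<le> \<alpha> \<Longrightarrow> u \<in> holder_space \<alpha> X \<Longrightarrow> continuous_on X u"
  using continuous_on_if_holder_seminorm_on_finite[of \<alpha> X u]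
  by (auto simp: holder_space_def split: if_splits)

lemma sup_norm_on_le_holder_seminorm_on:
  assumes x0: "x0 \<in> X" and D: "\<And>x. x \<in> X \<Longrightarrow> dist x x0 \<le> D" and "0 \<le> \<beta>"
  shows "sup_norm_on X u \<le> ennreal (norm (u x0)) + ennreal (D powr \<beta>) * holder_seminorm_on \<beta> X u"
proof (rule sup_norm_on_le)
  fix x assume x: "x \<in> X"
  have "norm (u x) \<le> norm (u x0) + norm (u x - u x0)"
    by (metis add.commute diff_add_cancel norm_triangle_ineq)
  then have "ennreal (norm (u x)) \<le> ennreal (norm (u x0)) + ennreal (norm (u x - u x0))"
    by (subst ennreal_plus[symmetric]) (auto simp del: ennreal_plus)
  also have "ennreal (norm (u x - u x0)) \<le> holder_seminorm_on \<beta> X u * ennreal (dist x x0 powr \<beta>)"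
    by (rule norm_diff_le_holder_seminorm_on[OF x x0])
  also have "\<dots> \<le> holder_seminorm_on \<beta> X u * ennreal (D powr \<beta>)"
    using D[OF x] \<open>0 \<le> \<beta>\<close> by (intro mult_left_mono ennreal_leI powr_mono2) auto
  finally show "ennreal (norm (u x)) \<le> ennreal (norm (u x0))
      + ennreal (D powr \<beta>) * holder_seminorm_on \<beta> X u"
    by (simp add: mult.commute add_left_mono)
qed

section \<open>Integrals depending on a parameter\<close>

lemma norm_integral_completion_le:
  fixes F :: "'a \<Rightarrow> 'd::{banach, second_countable_topology}"
  assumes "integrable (completion M) F" and "AE y in M. norm (F y) \<le> c y"
  shows "ennreal (norm (\<integral>y. F y \<partial>completion M)) \<le> (\<integral>\<^sup>+ y. ennreal (c y) \<partial>M)"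
proof -
  have "ennreal (norm (\<integral>y. F y \<partial>completion M)) \<le> (\<integral>\<^sup>+ y. ennreal (norm (F y)) \<partial>M)"
    using integral_norm_bound_ennreal[OF assms(1)] by (simp add: nn_integral_completion)
  also have "\<dots> \<le> (\<integral>\<^sup>+ y. ennreal (c y) \<partial>M)"
    by (rule nn_integral_mono_AE) (use assms(2) in \<open>eventually_elim, simp add: ennreal_leI\<close>)
  finally show ?thesis .
qed

text \<open>
  The constants of the individual functions \<open>\<lambda>x. F x y\<close> integrate to a constant for the integral.
  The exceptional null set may depend on the pair of points, since only one pair is compared at a
  time.
\<close>

lemma holder_seminorm_integral_le:
  fixes F :: "'b::metric_space \<Rightarrow> 'a \<Rightarrow> 'd::{banach, second_countable_topology}"
  assumes F: "\<And>x. x \<in> X \<Longrightarrow> integrable (completion M) (F x)"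
    and c: "c \<in> borel_measurable M"
    and bound: "\<And>x x'. x \<in> X \<Longrightarrow> x' \<in> X \<Longrightarrow>
      AE y in M. norm (F x y - F x' y) \<le> c y * dist x x' powr \<beta>"
  shows "holder_seminorm_on \<beta> X (\<lambda>x. \<integral>y. F x y \<partial>completion M) \<le> (\<integral>\<^sup>+ y. ennreal (c y) \<partial>M)"
proof (rule holder_seminorm_on_le)
  fix x x' assume x: "x \<in> X" "x' \<in> X"
  have "ennreal (norm ((\<integral>y. F x y \<partial>completion M) - (\<integral>y. F x' y \<partial>completion M)))
      = ennreal (norm (\<integral>y. F x y - F x' y \<partial>completion M))"
    using F x by simp
  also have "\<dots> \<le> (\<integral>\<^sup>+ y. ennreal (c y * dist x x' powr \<beta>) \<partial>M)"
    by (intro norm_integral_completion_le bound x Bochner_Integration.integrable_diff F)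
  also have "\<dots> = (\<integral>\<^sup>+ y. ennreal (c y) \<partial>M) * ennreal (dist x x' powr \<beta>)"
    using c by (simp add: ennreal_mult'' nn_integral_multc)
  finally show "ennreal (norm ((\<integral>y. F x y \<partial>completion M) - (\<integral>y. F x' y \<partial>completion M)))
      \<le> (\<integral>\<^sup>+ y. ennreal (c y) \<partial>M) * ennreal (dist x x' powr \<beta>)" .
qed

section \<open>The Urysohn operator\<close>

theorem theorem2p6:
  fixes \<Omega> :: "'a::metric_space set"
    and \<Omega>1 :: "'b::metric_space set"
    and M :: "'a measure"
    and Z :: "(real ^ 'n) set"
    and f :: "'b \<Rightarrow> 'a \<Rightarrow> real ^ 'n \<Rightarrow> real ^ 'd"
    and \<alpha> \<beta> :: real
  assumes "compact \<Omega>"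
    and "finite_measure M" and "space M = \<Omega>"
    and "sets (restrict_space borel \<Omega>) \<subseteq> sets M"
    and "Z \<noteq> {}"
    and "0 \<le> \<alpha>" "\<alpha> \<le> 1" "0 < \<beta>" "\<beta> \<le> 1"
    and a: "\<forall>x\<in>\<Omega>1. AE y in M. continuous_on Z (f x y)"
    and b: "\<forall>r>0. \<exists>h :: 'a \<Rightarrow> real. integrable M h \<and> (\<forall>y\<in>\<Omega>. 0 \<le> h y) \<and>
              (AE y in M. \<forall>x\<in>\<Omega>1. \<forall>x'\<in>\<Omega>1. \<forall>z\<in>Z \<inter> cball 0 r.
                 norm (f x y z - f x' y z) \<le> h y * dist x x' powr \<beta>)"
    and c_meas: "\<forall>x\<in>\<Omega>1. \<forall>z\<in>Z. (\<lambda>y. f x y z) \<in> borel_measurable M"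
    and c_bound: "\<forall>r>0. \<exists>b :: 'b \<Rightarrow> 'a \<Rightarrow> real.
              (\<forall>\<xi>\<in>\<Omega>1. b \<xi> \<in> borel_measurable M) \<and> (\<forall>\<xi>\<in>\<Omega>1. \<forall>y\<in>\<Omega>. 0 \<le> b \<xi> y) \<and>
              (SUP \<xi>\<in>\<Omega>1. \<integral>\<^sup>+ y. ennreal (b \<xi> y) \<partial>M) < \<infinity> \<and>
              (AE y in M. \<forall>x\<in>\<Omega>1. \<forall>z\<in>Z \<inter> cball 0 r. norm (f x y z) \<le> b x y)"
  shows
    \<comment> \<open>well-defined\<close>
    "(\<forall>u\<in>holder_maps \<alpha> \<Omega> Z.
        (\<forall>x\<in>\<Omega>1. integrable (completion M) (\<lambda>y. f x y (u y))) \<and>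
        urysohn M f u \<in> holder_space \<beta> \<Omega>1) \<and>
    \<comment> \<open>bounded\<close>
     (\<forall>S \<subseteq> holder_maps \<alpha> \<Omega> Z. (\<exists>R::real. \<forall>u\<in>S. sup_norm_on \<Omega> u \<le> ennreal R) \<longrightarrow>
        (\<exists>C::real. \<forall>u\<in>S. holder_norm_on \<beta> \<Omega>1 (urysohn M f u) \<le> ennreal C)) \<and>
    \<comment> \<open>continuous; (d) controls only the Hoelder seminorm, hence the full norm requires bounded \<open>\<Omega>1\<close>\<close>
     ((\<forall>r>0. \<exists>c :: real \<Rightarrow> 'a \<Rightarrow> real.
          (\<forall>\<delta>\<ge>0. c \<delta> \<in> borel_measurable M) \<and> (\<forall>\<delta>\<ge>0. \<forall>y\<in>\<Omega>. 0 \<le> c \<delta> y) \<and>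
          ((\<lambda>\<delta>. \<integral>\<^sup>+ y. ennreal (c \<delta> y) \<partial>M) \<longlongrightarrow> 0) (at_right 0) \<and>
          (AE y in M. \<forall>\<delta>>0. \<forall>x\<in>\<Omega>1. \<forall>x'\<in>\<Omega>1. \<forall>z\<in>Z \<inter> cball 0 r. \<forall>z'\<in>Z \<inter> cball 0 r.
             norm (z - z') \<le> \<delta> \<longrightarrow>
             norm (f x y z - f x y z' - (f x' y z - f x' y z')) \<le> c \<delta> y * dist x x' powr \<beta>)) \<longrightarrow>
      (\<forall>v u. (\<forall>l::nat. v l \<in> holder_maps \<alpha> \<Omega> Z) \<and> u \<in> holder_maps \<alpha> \<Omega> Z \<and>
          (\<lambda>l. sup_norm_on \<Omega> (\<lambda>y. v l y - u y)) \<longlonglongrightarrow> 0 \<longrightarrow>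
          (\<lambda>l. holder_seminorm_on \<beta> \<Omega>1 (\<lambda>x. urysohn M f (v l) x - urysohn M f u x)) \<longlonglongrightarrow> 0 \<and>
          (bounded \<Omega>1 \<longrightarrow>
           (\<lambda>l. holder_norm_on \<beta> \<Omega>1 (\<lambda>x. urysohn M f (v l) x - urysohn M f u x)) \<longlonglongrightarrow> 0)))"
proof -
  have maps: "u \<in> borel_measurable M" "u ` space M \<subseteq> Z"
    if "u \<in> holder_maps \<alpha> \<Omega> Z" for u
  proof -
    have "continuous_on \<Omega> u"
      using that \<open>0 \<le> \<alpha>\<close> holder_space_continuous_on by (auto simp: holder_maps_def)
    then have "u \<in> borel_measurable (restrict_space borel \<Omega>)"
      by (rule borel_measurable_continuous_on_restrict)
    then show "u \<in> borel_measurable M"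
      by (rule measurable_mono[OF order_refl refl assms(4), THEN subsetD, rotated])
         (simp add: space_restrict_space \<open>space M = \<Omega>\<close>)
    show "u ` space M \<subseteq> Z"
      using that \<open>space M = \<Omega>\<close> by (simp add: holder_maps_def)
  qed
  have maps_bounded: "\<exists>r>0. \<forall>y\<in>\<Omega>. norm (u y) \<le> r" if "u \<in> holder_maps \<alpha> \<Omega> Z" for u
    using that by (auto simp: holder_maps_def holder_space_def bounded_pos)
  \<comment> \<open>This holds at every point; the weaker form lets it be combined with the almost everywhere
    bounds of the hypotheses.\<close>
  have in_ball: "AE y in M. u y \<in> Z \<inter> cball 0 r"
    if "u \<in> holder_maps \<alpha> \<Omega> Z" "\<forall>y\<in>\<Omega>. norm (u y) \<le> r" for u r
    using that maps(2)[OF that(1)] \<open>space M = \<Omega>\<close> by (intro AE_I2) auto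

  \<comment> \<open>The radius fixes one family of majorants for all maps with values in that ball, which is what
    makes the later bounds uniform in \<open>u\<close>.\<close>
  have majorant: "\<exists>b. (\<forall>x\<in>\<Omega>1. integrable M (b x)) \<and>
      (SUP x\<in>\<Omega>1. \<integral>\<^sup>+ y. ennreal (b x y) \<partial>M) < \<infinity> \<and>
      (\<forall>x\<in>\<Omega>1. \<forall>u\<in>holder_maps \<alpha> \<Omega> Z. (\<forall>y\<in>\<Omega>. norm (u y) \<le> r) \<longrightarrow>
        (AE y in M. norm (f x y (u y)) \<le> b x y))" if "0 < r" for r
  proof -
    obtain b :: "'b \<Rightarrow> 'a \<Rightarrow> real" where
        b_meas: "\<forall>\<xi>\<in>\<Omega>1. b \<xi> \<in> borel_measurable M" and b_nonneg: "\<forall>\<xi>\<in>\<Omega>1. \<forall>y\<in>\<Omega>. 0 \<le> b \<xi> y"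
      and b_sup: "(SUP \<xi>\<in>\<Omega>1. \<integral>\<^sup>+ y. ennreal (b \<xi> y) \<partial>M) < \<infinity>"
      and b_bound: "AE y in M. \<forall>x\<in>\<Omega>1. \<forall>z\<in>Z \<inter> cball 0 r. norm (f x y z) \<le> b x y"
      using c_bound \<open>0 < r\<close> by blast
    have "integrable M (b x)" if x: "x \<in> \<Omega>1" for x
    proof (rule integrableI_bounded)
      have "(\<integral>\<^sup>+ y. ennreal (norm (b x y)) \<partial>M) = (\<integral>\<^sup>+ y. ennreal (b x y) \<partial>M)"
        using b_nonneg x \<open>space M = \<Omega>\<close> by (intro nn_integral_cong) auto
      also have "\<dots> < \<infinity>"
        by (rule le_less_trans[OF SUP_upper[OF x] b_sup])
      finally show "(\<integral>\<^sup>+ y. ennreal (norm (b x y)) \<partial>M) < \<infinity>" .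
    qed (use b_meas x in blast)
    moreover have "AE y in M. norm (f x y (u y)) \<le> b x y"
      if "x \<in> \<Omega>1" "u \<in> holder_maps \<alpha> \<Omega> Z" "\<forall>y\<in>\<Omega>. norm (u y) \<le> r" for x u
      using b_bound in_ball[OF that(2,3)] by eventually_elim (use that in blast)
    ultimately show ?thesis using b_sup by blast
  qed

  have meas: "(\<lambda>y. f x y (u y)) \<in> borel_measurable (completion M)"
    if "x \<in> \<Omega>1" "u \<in> holder_maps \<alpha> \<Omega> Z" for x u
    using that c_meas a by (intro borel_measurable_completion_superposition[OF maps[OF that(2)]]) auto

  have integrable: "integrable (completion M) (\<lambda>y. f x y (u y))"
    if x: "x \<in> \<Omega>1" and u: "u \<in> holder_maps \<alpha> \<Omega> Z" for x u
  proof -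
    obtain r where "0 < r" "\<forall>y\<in>\<Omega>. norm (u y) \<le> r"
      using maps_bounded[OF u] by blast
    then obtain b where b: "integrable M b" "AE y in M. norm (f x y (u y)) \<le> b y"
      using majorant[of r] x u by blast
    show ?thesis
    proof (rule Bochner_Integration.integrable_bound[OF _ meas[OF x u]])
      show "integrable (completion M) b" using b(1) by (simp add: integrable_completion)
      show "AE y in completion M. norm (f x y (u y)) \<le> norm (b y)"
        using AE_completion[OF b(2)] by eventually_elim simp
    qed
  qed

  have norm_bound: "\<exists>C::real. \<forall>u\<in>holder_maps \<alpha> \<Omega> Z. (\<forall>y\<in>\<Omega>. norm (u y) \<le> r) \<longrightarrow>
      sup_norm_on \<Omega>1 (urysohn M f u) \<le> ennreal C \<and>
      holder_seminorm_on \<beta> \<Omega>1 (urysohn M f u) \<le> ennreal C" if "0 < r" for r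
  proof -
    obtain b where b_sup: "(SUP x\<in>\<Omega>1. \<integral>\<^sup>+ y. ennreal (b x y) \<partial>M) < \<infinity>"
      and b_bound: "\<forall>x\<in>\<Omega>1. \<forall>u\<in>holder_maps \<alpha> \<Omega> Z. (\<forall>y\<in>\<Omega>. norm (u y) \<le> r) \<longrightarrow>
        (AE y in M. norm (f x y (u y)) \<le> b x y)"
      using majorant[OF \<open>0 < r\<close>] by blast
    obtain h where h: "integrable M h" "\<forall>y\<in>\<Omega>. (0::real) \<le> h y"
      and h_bound: "AE y in M. \<forall>x\<in>\<Omega>1. \<forall>x'\<in>\<Omega>1. \<forall>z\<in>Z \<inter> cball 0 r.
        norm (f x y z - f x' y z) \<le> h y * dist x x' powr \<beta>"
      using b \<open>0 < r\<close> by blast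
    have h_fin: "(\<integral>\<^sup>+ y. ennreal (h y) \<partial>M) = ennreal (\<integral>y. h y \<partial>M)"
      using h \<open>space M = \<Omega>\<close> by (intro nn_integral_eq_integral) auto
    obtain B where B: "(SUP x\<in>\<Omega>1. \<integral>\<^sup>+ y. ennreal (b x y) \<partial>M) = ennreal B"
      using b_sup by (cases "SUP x\<in>\<Omega>1. \<integral>\<^sup>+ y. ennreal (b x y) \<partial>M") auto
    have "sup_norm_on \<Omega>1 (urysohn M f u) \<le> ennreal B \<and>
        holder_seminorm_on \<beta> \<Omega>1 (urysohn M f u) \<le> ennreal (\<integral>y. h y \<partial>M)"
      if u: "u \<in> holder_maps \<alpha> \<Omega> Z" "\<forall>y\<in>\<Omega>. norm (u y) \<le> r" for u
    proof
      show "sup_norm_on \<Omega>1 (urysohn M f u) \<le> ennreal B"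
        unfolding urysohn_def B[symmetric]
        by (intro sup_norm_on_le SUP_upper2 norm_integral_completion_le integrable)
           (use u b_bound in blast)+
      show "holder_seminorm_on \<beta> \<Omega>1 (urysohn M f u) \<le> ennreal (\<integral>y. h y \<partial>M)"
        unfolding urysohn_def h_fin[symmetric]
      proof (rule holder_seminorm_integral_le)
        fix x x' assume x: "x \<in> \<Omega>1" "x' \<in> \<Omega>1"
        show "AE y in M. norm (f x y (u y) - f x' y (u y)) \<le> h y * dist x x' powr \<beta>"
          using h_bound in_ball[OF u] by eventually_elim (use x in blast)
      qed (use h integrable u in auto)
    qed
    then show ?thesis
      by (intro exI[of _ "max B (\<integral>y. h y \<partial>M)"])
         (meson ennreal_leI max.cobounded1 max.cobounded2 order_trans)
  qed

  have well_defined: "urysohn M f u \<in> holder_space \<beta> \<Omega>1" if u: "u \<in> holder_maps \<alpha> \<Omega> Z" for u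
  proof -
    obtain C :: real where "sup_norm_on \<Omega>1 (urysohn M f u) \<le> ennreal C"
        "holder_seminorm_on \<beta> \<Omega>1 (urysohn M f u) \<le> ennreal C"
      using maps_bounded[OF u] norm_bound u by metis
    then have "sup_norm_on \<Omega>1 (urysohn M f u) < \<infinity>" "holder_seminorm_on \<beta> \<Omega>1 (urysohn M f u) < \<infinity>"
      by (auto intro: le_less_trans)
    then show ?thesis
      using bounded_image_if_sup_norm_on_finite \<open>0 < \<beta>\<close> by (auto simp: holder_space_def)
  qed

  have bounded_op: "\<exists>C::real. \<forall>u\<in>S. holder_norm_on \<beta> \<Omega>1 (urysohn M f u) \<le> ennreal C"
    if S: "S \<subseteq> holder_maps \<alpha> \<Omega> Z" and R: "\<forall>u\<in>S. sup_norm_on \<Omega> u \<le> ennreal R" for S and R :: real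
  proof -
    have "norm (u y) \<le> max R 1" if "u \<in> S" "y \<in> \<Omega>" for u y
    proof -
      have "ennreal (norm (u y)) \<le> ennreal R"
        using norm_le_sup_norm_on[OF that(2)] R that(1) by (meson order_trans)
      then show ?thesis by (cases "0 \<le> R") (auto simp: ennreal_neg)
    qed
    \<comment> \<open>\<open>R\<close> may be nonpositive, whereas the hypotheses are available for positive radii.\<close>
    then show ?thesis
      using norm_bound[of "max R 1"] S \<open>0 < \<beta>\<close> by (fastforce simp: holder_norm_on_def)
  qed

  have continuity:
    "(\<lambda>l. holder_seminorm_on \<beta> \<Omega>1 (\<lambda>x. urysohn M f (v l) x - urysohn M f u x)) \<longlonglongrightarrow> 0 \<and>
     (bounded \<Omega>1 \<longrightarrow>
       (\<lambda>l. holder_norm_on \<beta> \<Omega>1 (\<lambda>x. urysohn M f (v l) x - urysohn M f u x)) \<longlonglongrightarrow> 0)"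
    if d: "\<forall>r>0. \<exists>c :: real \<Rightarrow> 'a \<Rightarrow> real.
          (\<forall>\<delta>\<ge>0. c \<delta> \<in> borel_measurable M) \<and> (\<forall>\<delta>\<ge>0. \<forall>y\<in>\<Omega>. 0 \<le> c \<delta> y) \<and>
          ((\<lambda>\<delta>. \<integral>\<^sup>+ y. ennreal (c \<delta> y) \<partial>M) \<longlongrightarrow> 0) (at_right 0) \<and>
          (AE y in M. \<forall>\<delta>>0. \<forall>x\<in>\<Omega>1. \<forall>x'\<in>\<Omega>1. \<forall>z\<in>Z \<inter> cball 0 r. \<forall>z'\<in>Z \<inter> cball 0 r.
             norm (z - z') \<le> \<delta> \<longrightarrow>
             norm (f x y z - f x y z' - (f x' y z - f x' y z')) \<le> c \<delta> y * dist x x' powr \<beta>)"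
      and v: "\<forall>l::nat. v l \<in> holder_maps \<alpha> \<Omega> Z" and u: "u \<in> holder_maps \<alpha> \<Omega> Z"
      and lim: "(\<lambda>l. sup_norm_on \<Omega> (\<lambda>y. v l y - u y)) \<longlonglongrightarrow> 0"
    for v u
  proof -
    let ?W = "\<lambda>l x. urysohn M f (v l) x - urysohn M f u x"
    have W_eq: "?W l x = (\<integral>y. f x y (v l y) - f x y (u y) \<partial>completion M)" if "x \<in> \<Omega>1" for l x
      unfolding urysohn_def using integrable[OF that] v u by simp
    have close: "\<forall>\<^sub>F l in sequentially. \<forall>y\<in>\<Omega>. norm (v l y - u y) \<le> \<delta>" if "0 < \<delta>" for \<delta> :: real
    proof -
      have "\<forall>\<^sub>F l in sequentially. sup_norm_on \<Omega> (\<lambda>y. v l y - u y) < ennreal \<delta>"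
        using that by (intro order_tendstoD(2)[OF lim]) simp
      then show ?thesis
      proof eventually_elim
        case (elim l)
        show ?case
        proof
          fix y assume "y \<in> \<Omega>"
          then have "ennreal (norm (v l y - u y)) < ennreal \<delta>"
            using norm_le_sup_norm_on[of y \<Omega> "\<lambda>y. v l y - u y"] elim by (meson le_less_trans)
          then show "norm (v l y - u y) \<le> \<delta>" by (simp add: ennreal_less_iff)
        qed
      qed
    qed
    obtain \<rho> where \<rho>: "0 < \<rho>" "\<forall>y\<in>\<Omega>. norm (u y) \<le> \<rho>"
      using maps_bounded[OF u] by blast
    \<comment> \<open>Uniform convergence keeps almost all \<open>v l\<close> within distance \<open>1\<close> of \<open>u\<close>, so that the
      hypotheses for one radius serve all of them.\<close>
    define r where "r = \<rho> + 1"
    have r: "0 < r" "\<forall>y\<in>\<Omega>. norm (u y) \<le> r"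
      using \<rho> by (auto simp: r_def intro: order_trans)
    have v_ball: "\<forall>\<^sub>F l in sequentially. \<forall>y\<in>\<Omega>. norm (v l y) \<le> r"
      using close[OF zero_less_one]
    proof eventually_elim
      case (elim l)
      show ?case
      proof
        fix y assume "y \<in> \<Omega>"
        then show "norm (v l y) \<le> r"
          using elim \<rho>(2) norm_triangle_sub[of "v l y" "u y"] by (fastforce simp: r_def)
      qed
    qed

    have semi: "(\<lambda>l. holder_seminorm_on \<beta> \<Omega>1 (?W l)) \<longlonglongrightarrow> 0"
    proof (rule tendsto_zero_ennreal)
      fix \<epsilon> :: real assume "0 < \<epsilon>"
      obtain c :: "real \<Rightarrow> 'a \<Rightarrow> real" where c_meas: "\<forall>\<delta>\<ge>0. c \<delta> \<in> borel_measurable M"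
        and c_lim: "((\<lambda>\<delta>. \<integral>\<^sup>+ y. ennreal (c \<delta> y) \<partial>M) \<longlongrightarrow> 0) (at_right 0)"
        and c_bound: "AE y in M. \<forall>\<delta>>0. \<forall>x\<in>\<Omega>1. \<forall>x'\<in>\<Omega>1. \<forall>z\<in>Z \<inter> cball 0 r. \<forall>z'\<in>Z \<inter> cball 0 r.
             norm (z - z') \<le> \<delta> \<longrightarrow>
             norm (f x y z - f x y z' - (f x' y z - f x' y z')) \<le> c \<delta> y * dist x x' powr \<beta>"
        using d r(1) by blast
      have "\<forall>\<^sub>F \<delta> in at_right 0. (\<integral>\<^sup>+ y. ennreal (c \<delta> y) \<partial>M) < ennreal \<epsilon>"
        using \<open>0 < \<epsilon>\<close> by (intro order_tendstoD(2)[OF c_lim]) simp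
      then have "\<forall>\<^sub>F \<delta> in at_right 0. 0 < \<delta> \<and> (\<integral>\<^sup>+ y. ennreal (c \<delta> y) \<partial>M) < ennreal \<epsilon>"
        using eventually_at_right_less[of "0::real"] by eventually_elim simp
      then obtain \<delta> where \<delta>: "0 < \<delta>" "(\<integral>\<^sup>+ y. ennreal (c \<delta> y) \<partial>M) < ennreal \<epsilon>"
        by (auto dest: eventually_happens'[rotated])
      show "\<forall>\<^sub>F l in sequentially. holder_seminorm_on \<beta> \<Omega>1 (?W l) < ennreal \<epsilon>"
        using close[OF \<delta>(1)] v_ball
      proof eventually_elim
        case (elim l)
        have vl: "v l \<in> holder_maps \<alpha> \<Omega> Z" using v by blast
        have "holder_seminorm_on \<beta> \<Omega>1 (?W l)
            = holder_seminorm_on \<beta> \<Omega>1 (\<lambda>x. \<integral>y. f x y (v l y) - f x y (u y) \<partial>completion M)"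
          unfolding holder_seminorm_on_def by (intro SUP_cong refl) (auto simp: W_eq)
        also have "\<dots> \<le> (\<integral>\<^sup>+ y. ennreal (c \<delta> y) \<partial>M)"
        proof (rule holder_seminorm_integral_le)
          fix x x' assume x: "x \<in> \<Omega>1" "x' \<in> \<Omega>1"
          have "AE y in M. norm (v l y - u y) \<le> \<delta>"
            using elim(1) \<open>space M = \<Omega>\<close> by (intro AE_I2) simp
          with c_bound in_ball[OF vl elim(2)] in_ball[OF u r(2)]
          show "AE y in M. norm (f x y (v l y) - f x y (u y) - (f x' y (v l y) - f x' y (u y)))
              \<le> c \<delta> y * dist x x' powr \<beta>"
            by eventually_elim (use x \<delta>(1) in blast)
        qed (use c_meas \<delta>(1) integrable vl u in auto)
        finally show ?case using \<delta>(2) by (rule le_less_trans)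
      qed
    qed

    have "(\<lambda>l. holder_norm_on \<beta> \<Omega>1 (?W l)) \<longlonglongrightarrow> 0" if "bounded \<Omega>1"
    proof -
      have "(\<lambda>l. sup_norm_on \<Omega>1 (?W l)) \<longlonglongrightarrow> 0"
      proof (cases "\<Omega>1 = {}")
        case True
        then show ?thesis by (simp add: sup_norm_on_def bot_ennreal)
      next
        case False
        then obtain x0 where x0: "x0 \<in> \<Omega>1" by blast
        obtain D where D: "\<And>x. x \<in> \<Omega>1 \<Longrightarrow> dist x x0 \<le> D"
          using \<open>bounded \<Omega>1\<close> by (metis bounded_any_center dist_commute)
        obtain b where b: "integrable M b" "\<forall>w\<in>holder_maps \<alpha> \<Omega> Z.
            (\<forall>y\<in>\<Omega>. norm (w y) \<le> r) \<longrightarrow> (AE y in M. norm (f x0 y (w y)) \<le> b y)"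
          using majorant[OF r(1)] x0 by blast
        \<comment> \<open>The majorant applies from index \<open>L\<close> on, so dominated convergence is used for the
          shifted sequence.\<close>
        obtain L where L: "\<And>l. L \<le> l \<Longrightarrow> \<forall>y\<in>\<Omega>. norm (v l y) \<le> r"
          using v_ball by (auto simp: eventually_sequentially)
        have v_lim: "(\<lambda>l. v (l + L) y) \<longlonglongrightarrow> u y" if "y \<in> \<Omega>" for y
        proof (rule LIMSEQ_ignore_initial_segment[OF tendstoI])
          fix e :: real assume "0 < e"
          then have "\<forall>\<^sub>F l in sequentially. \<forall>y\<in>\<Omega>. norm (v l y - u y) \<le> e / 2"
            by (intro close) simp
          then show "\<forall>\<^sub>F l in sequentially. dist (v l y) (u y) < e"
            by eventually_elim (use that \<open>0 < e\<close> in \<open>force simp: dist_norm\<close>)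
        qed
        have "(\<lambda>l. \<integral>y. f x0 y (v (l + L) y) \<partial>completion M)
            \<longlonglongrightarrow> (\<integral>y. f x0 y (u y) \<partial>completion M)"
        proof (rule integral_dominated_convergence)
          show "integrable (completion M) b"
            using b(1) by (simp add: integrable_completion)
          show "AE y in completion M. norm (f x0 y (v (l + L) y)) \<le> b y" for l
            using b(2) v L by (intro AE_completion) simp
          show "AE y in completion M. (\<lambda>l. f x0 y (v (l + L) y)) \<longlonglongrightarrow> f x0 y (u y)"
          proof (rule AE_completion)
            have "AE y in M. continuous_on Z (f x0 y)" using a x0 by blast
            then show "AE y in M. (\<lambda>l. f x0 y (v (l + L) y)) \<longlonglongrightarrow> f x0 y (u y)"
              using AE_space
            proof eventually_elim
              case (elim y)
              then have "y \<in> \<Omega>" using \<open>space M = \<Omega>\<close> by simp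
              moreover have "u y \<in> Z" "v l y \<in> Z" for l
                using maps(2) u v elim(2) by blast+
              ultimately show ?case
                by (intro continuous_on_tendsto_compose[OF elim(1) v_lim] always_eventually) auto
            qed
          qed
        qed (use meas x0 u v in auto)
        then have "(\<lambda>l. urysohn M f (v l) x0) \<longlonglongrightarrow> urysohn M f u x0"
          unfolding urysohn_def by (rule LIMSEQ_offset)
        then have "(\<lambda>l. norm (?W l x0)) \<longlonglongrightarrow> 0"
          by (intro tendsto_norm_zero) (simp add: LIM_zero)
        then have "(\<lambda>l. ennreal (norm (?W l x0))) \<longlonglongrightarrow> 0"
          by (simp add: ennreal_tendsto_0_iff)
        then have "(\<lambda>l. ennreal (norm (?W l x0)) + ennreal (D powr \<beta>) * holder_seminorm_on \<beta> \<Omega>1 (?W l))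
            \<longlonglongrightarrow> 0 + ennreal (D powr \<beta>) * 0"
          by (intro tendsto_add ennreal_tendsto_cmult semi ennreal_less_top)
        then have bound_lim:
          "(\<lambda>l. ennreal (norm (?W l x0)) + ennreal (D powr \<beta>) * holder_seminorm_on \<beta> \<Omega>1 (?W l))
            \<longlonglongrightarrow> 0" by simp
        show ?thesis
        proof (rule tendsto_sandwich[OF _ _ tendsto_const bound_lim])
          show "\<forall>\<^sub>F l in sequentially. sup_norm_on \<Omega>1 (?W l)
              \<le> ennreal (norm (?W l x0)) + ennreal (D powr \<beta>) * holder_seminorm_on \<beta> \<Omega>1 (?W l)"
          proof (intro always_eventually allI)
            fix l
            show "sup_norm_on \<Omega>1 (?W l)
                \<le> ennreal (norm (?W l x0)) + ennreal (D powr \<beta>) * holder_seminorm_on \<beta> \<Omega>1 (?W l)"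
              by (rule sup_norm_on_le_holder_seminorm_on[OF x0 D less_imp_le[OF \<open>0 < \<beta>\<close>]])
          qed
        qed simp
      qed
      then have "(\<lambda>l. max (sup_norm_on \<Omega>1 (?W l)) (holder_seminorm_on \<beta> \<Omega>1 (?W l))) \<longlonglongrightarrow> max 0 0"
        by (intro tendsto_max semi)
      then show ?thesis using \<open>0 < \<beta>\<close> by (simp add: holder_norm_on_def)
    qed
    with semi show ?thesis by blast
  qed

  show ?thesis
  proof (rule conjI[OF _ conjI])
    show "\<forall>u\<in>holder_maps \<alpha> \<Omega> Z.
        (\<forall>x\<in>\<Omega>1. integrable (completion M) (\<lambda>y. f x y (u y))) \<and>
        urysohn M f u \<in> holder_space \<beta> \<Omega>1"
      by (intro ballI conjI integrable well_defined)
    show "\<forall>S \<subseteq> holder_maps \<alpha> \<Omega> Z. (\<exists>R::real. \<forall>u\<in>S. sup_norm_on \<Omega> u \<le> ennreal R) \<longrightarrow>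
        (\<exists>C::real. \<forall>u\<in>S. holder_norm_on \<beta> \<Omega>1 (urysohn M f u) \<le> ennreal C)"
      by (intro allI impI, erule exE, rule bounded_op)
  qed (rule impI, intro allI impI, elim conjE, rule continuity)
qed

end
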